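(* Let $n \geq 2$, let $G$ be a finite nilpotent group of class at most $n$ and let $H$ be a central subgroup of $G$ such that $\gamma_n(G)\leq H$. Then $Aut_{c}^{n-1}(G)$ is isomorphic to $Hom_{c}(G/H, \gamma_n(G))$.
   Context: $\gamma_n(G)$ is the $n$-th term of the lower central series of $G$, with $\gamma_1(G)=G$. A subgroup $H$ of $G$ is central if $H \subseteq Z(G)$, the center of $G$. For $m \geq 1$, an automorphism $\beta$ of $G$ is called $m$-th class preserving if for each $g\in G$ there exists $x\in \gamma_{m}(G)$ (depending on $g$) such that $\beta(g)= x^{-1}gx$; the group of all $m$-th class preserving automorphisms is denoted $Aut_{c}^{m}(G)$. For a nilpotent group $G$ of class at most $n$ and a central subgroup $H$ of $G$, $Hom_{c}(G/H, \gamma_n(G))$ denotes the group $\{f\in Hom(G/H,\gamma_n(G)) : f(gH)\in [g,\gamma_{n-1}(G)] \text{ for all } g\in G\}$ under pointwise multiplication, where $[g,\gamma_{n-1}(G)] = \{[g,x] : x \in \gamma_{n-1}(G)\}$ and $[g,x] = g^{-1}x^{-1}gx$. *)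

theory Defs
  imports "HOL-Algebra.Generated_Groups" "HOL-Algebra.Bij"
begin

definition group_center :: "('a, 'b) monoid_scheme \<Rightarrow> 'a set"
  where "group_center G =
    {z \<in> carrier G. \<forall>g \<in> carrier G. z \<otimes>\<^bsub>G\<^esub> g = g \<otimes>\<^bsub>G\<^esub> z}"

definition central_subgroup :: "'a set \<Rightarrow> ('a, 'b) monoid_scheme \<Rightarrow> bool"
  where "central_subgroup H G \<longleftrightarrow> subgroup H G \<and> H \<subseteq> group_center G"

definition commutator :: "('a, 'b) monoid_scheme \<Rightarrow> 'a \<Rightarrow> 'a \<Rightarrow> 'a"
  where "commutator G x y = inv\<^bsub>G\<^esub> x \<otimes>\<^bsub>G\<^esub> inv\<^bsub>G\<^esub> y \<otimes>\<^bsub>G\<^esub> x \<otimes>\<^bsub>G\<^esub> y"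

text \<open>The series is indexed from 1; the value at index 0 is only a convention.\<close>

fun lower_central :: "('a, 'b) monoid_scheme \<Rightarrow> nat \<Rightarrow> 'a set"
  where
    "lower_central G 0 = carrier G"
  | "lower_central G (Suc 0) = carrier G"
  | "lower_central G (Suc (Suc i)) =
      generate G {commutator G x g | x g. x \<in> lower_central G (Suc i) \<and> g \<in> carrier G}"

definition nilpotent_group :: "('a, 'b) monoid_scheme \<Rightarrow> bool"
  where "nilpotent_group G \<longleftrightarrow> group G \<and> (\<exists>c. lower_central G (Suc c) = {\<one>\<^bsub>G\<^esub>})"

text \<open>Only meaningful for nilpotent groups.\<close>

definition nilpotency_class :: "('a, 'b) monoid_scheme \<Rightarrow> nat"
  where "nilpotency_class G = (LEAST c. lower_central G (Suc c) = {\<one>\<^bsub>G\<^esub>})"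

definition class_preserving_auto :: "nat \<Rightarrow> ('a, 'b) monoid_scheme \<Rightarrow> ('a \<Rightarrow> 'a) set"
  where "class_preserving_auto m G =
    {\<beta> \<in> auto G. \<forall>g \<in> carrier G. \<exists>x \<in> lower_central G m.
       \<beta> g = inv\<^bsub>G\<^esub> x \<otimes>\<^bsub>G\<^esub> g \<otimes>\<^bsub>G\<^esub> x}"

definition Autc :: "nat \<Rightarrow> ('a, 'b) monoid_scheme \<Rightarrow> ('a \<Rightarrow> 'a) monoid"
  where "Autc m G = AutoGroup G \<lparr>carrier := class_preserving_auto m G\<rparr>"

text \<open>
  Homomorphisms are represented by extensional functions, as in \<^const>\<open>AutoGroup\<close>, so that
  functions agreeing on the cosets of \<open>H\<close> are identified. The elements of \<open>G Mod H\<close> are the right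
  cosets \<open>H #> g\<close>; for the central subgroups \<open>H\<close> considered here these are also the left cosets.
\<close>

definition Homc :: "('a, 'b) monoid_scheme \<Rightarrow> 'a set \<Rightarrow> nat \<Rightarrow> ('a set \<Rightarrow> 'a) monoid"
  where "Homc G H n =
    \<lparr>carrier = {f \<in> hom (G Mod H) (G\<lparr>carrier := lower_central G n\<rparr>).
        f \<in> extensional (carrier (G Mod H)) \<and>
        (\<forall>g \<in> carrier G. f (H #>\<^bsub>G\<^esub> g) \<in> {commutator G g x | x. x \<in> lower_central G (n - 1)})},
     mult = (\<lambda>f f'. \<lambda>C \<in> carrier (G Mod H). f C \<otimes>\<^bsub>G\<^esub> f' C),
     one = (\<lambda>C \<in> carrier (G Mod H). \<one>\<^bsub>G\<^esub>)\<rparr>"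

text \<open>Both structures are groups.\<close>

context group
begin

lemma lower_central_subgroup: "subgroup (lower_central G i) G"
proof (induction G\<equiv>G i rule: lower_central.induct)
  case (3 i)
  then have "lower_central G (Suc i) \<subseteq> carrier G"
    by (simp add: subgroup.subset)
  then show ?case
    by (auto simp: commutator_def subset_iff intro!: generate_is_subgroup)
qed (auto simp: subgroup_self)

lemma class_preserving_auto_subgroup: "subgroup (class_preserving_auto m G) (AutoGroup G)"
proof -
  interpret A: group "AutoGroup G" by (rule AutoGroup)
  let ?L = "lower_central G m"
  interpret L: subgroup ?L G by (rule lower_central_subgroup)
  have car: "carrier (AutoGroup G) = auto G" by (simp add: AutoGroup_def)
  have mult: "(\<beta> \<otimes>\<^bsub>AutoGroup G\<^esub> \<beta>') g = \<beta> (\<beta>' g)"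
    if "\<beta> \<in> auto G" "\<beta>' \<in> auto G" "g \<in> carrier G" for \<beta> \<beta>' g
    using that by (simp add: AutoGroup_def BijGroup_def auto_def compose_def)
  have one: "\<one>\<^bsub>AutoGroup G\<^esub> g = g" if "g \<in> carrier G" for g
    using that by (simp add: AutoGroup_def BijGroup_def)
  have closed: "\<beta> g \<in> carrier G" if "\<beta> \<in> auto G" "g \<in> carrier G" for \<beta> g
    using that by (auto simp: auto_def hom_def)
  show ?thesis
  proof (rule A.subgroupI)
    show "class_preserving_auto m G \<subseteq> carrier (AutoGroup G)"
      by (auto simp: class_preserving_auto_def car)
    have "\<one>\<^bsub>AutoGroup G\<^esub> \<in> class_preserving_auto m G"
      using A.one_closed by (auto simp: class_preserving_auto_def car one intro!: bexI[of _ \<one>])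
    then show "class_preserving_auto m G \<noteq> {}" by blast
  next
    fix \<beta> assume \<beta>: "\<beta> \<in> class_preserving_auto m G"
    then have a: "\<beta> \<in> auto G" by (simp add: class_preserving_auto_def)
    let ?i = "inv\<^bsub>AutoGroup G\<^esub> \<beta>"
    have i: "?i \<in> auto G" using A.inv_closed a car by blast
    have "\<exists>x\<in>?L. ?i g = inv x \<otimes> g \<otimes> x" if g: "g \<in> carrier G" for g
    proof -
      have ig: "?i g \<in> carrier G" using closed i g by blast
      have "\<beta> (?i g) = g"
        using mult[OF a i g] A.r_inv[of \<beta>] a one[OF g] by (simp add: car)
      then obtain x where x: "x \<in> ?L" "g = inv x \<otimes> ?i g \<otimes> x"
        using \<beta> ig by (auto simp: class_preserving_auto_def)
      then have "?i g = x \<otimes> g \<otimes> inv x"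
        using ig L.mem_carrier by (metis inv_closed inv_solve_left inv_solve_right m_assoc m_closed)
      then show ?thesis
        using x(1) L.mem_carrier by (intro bexI[of _ "inv x"]) auto
    qed
    then show "?i \<in> class_preserving_auto m G" using i by (simp add: class_preserving_auto_def)
  next
    fix \<beta> \<beta>' assume b: "\<beta> \<in> class_preserving_auto m G" "\<beta>' \<in> class_preserving_auto m G"
    then have a: "\<beta> \<in> auto G" "\<beta>' \<in> auto G" by (simp_all add: class_preserving_auto_def)
    have "\<exists>x\<in>?L. \<beta> (\<beta>' g) = inv x \<otimes> g \<otimes> x" if g: "g \<in> carrier G" for g
    proof -
      obtain y where y: "y \<in> ?L" "\<beta>' g = inv y \<otimes> g \<otimes> y"
        using b(2) g by (auto simp: class_preserving_auto_def)
      obtain x where x: "x \<in> ?L" "\<beta> (\<beta>' g) = inv x \<otimes> \<beta>' g \<otimes> x"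
        using b(1) closed[OF a(2) g] by (auto simp: class_preserving_auto_def)
      have "\<beta> (\<beta>' g) = inv (y \<otimes> x) \<otimes> g \<otimes> (y \<otimes> x)"
        using x y g L.mem_carrier by (simp add: inv_mult_group m_assoc)
      then show ?thesis using x(1) y(1) by blast
    qed
    moreover have "\<beta> \<otimes>\<^bsub>AutoGroup G\<^esub> \<beta>' \<in> auto G" using A.m_closed a car by blast
    ultimately show "\<beta> \<otimes>\<^bsub>AutoGroup G\<^esub> \<beta>' \<in> class_preserving_auto m G"
      using a by (simp add: class_preserving_auto_def mult)
  qed
qed

lemma group_Autc: "group (Autc m G)"
  unfolding Autc_def
  by (rule subgroup.subgroup_is_group[OF class_preserving_auto_subgroup AutoGroup])

lemma group_Homc:
  assumes "central_subgroup H G" "lower_central G n \<subseteq> H"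
  shows "group (Homc G H n)"
proof -
  let ?L = "lower_central G n" and ?K = "lower_central G (n - 1)" and ?Q = "G Mod H"
  interpret L: subgroup ?L G by (rule lower_central_subgroup)
  interpret K: subgroup ?K G by (rule lower_central_subgroup)
  have comm: "c \<otimes> g = g \<otimes> c" if "c \<in> ?L" "g \<in> carrier G" for c g
    using that assms by (auto simp: central_subgroup_def group_center_def)
  have Hsub: "subgroup H G" using assms by (simp add: central_subgroup_def)
  have "x \<otimes> h \<otimes> inv x = h" if "x \<in> carrier G" "h \<in> H" for x h
    using that assms subgroup.mem_carrier[OF Hsub]
    by (auto simp: central_subgroup_def group_center_def inv_solve_right')
  then have "H \<lhd> G" using Hsub by (simp add: normal_inv_iff)
  then interpret Q: group ?Q by (rule normal.factorgroup_is_group)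
  have coset: "H #> g \<in> carrier ?Q" if "g \<in> carrier G" for g
    using that by (auto simp: FactGroup_def RCOSETS_def)
  have com_closed: "commutator G g x \<in> carrier G" if "g \<in> carrier G" "x \<in> carrier G" for g x
    using that by (simp add: commutator_def)
  have prod: "commutator G g x \<otimes> commutator G g y = commutator G g (x \<otimes> y)"
    if "commutator G g x \<in> ?L" "g \<in> carrier G" "x \<in> carrier G" "y \<in> carrier G" for g x y
  proof -
    have c: "commutator G g x \<in> carrier G" using that by (simp add: commutator_def)
    have cancel: "g \<otimes> (inv g \<otimes> z) = z" if "z \<in> carrier G" for z
      using that \<open>g \<in> carrier G\<close> by (simp add: m_assoc[symmetric])
    have "commutator G g (x \<otimes> y) = inv g \<otimes> inv y \<otimes> g \<otimes> (commutator G g x \<otimes> y)"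
      using that by (simp add: commutator_def inv_mult_group m_assoc cancel)
    also have "\<dots> = commutator G g y \<otimes> commutator G g x"
      using that c by (simp add: comm m_assoc commutator_def[of G g y])
    also have "\<dots> = commutator G g x \<otimes> commutator G g y"
      using comm[of "commutator G g x" "commutator G g y"] that by (simp add: com_closed)
    finally show ?thesis by simp
  qed
  have inv_comm: "inv (commutator G g x) = commutator G g (inv x)"
    if "commutator G g x \<in> ?L" "g \<in> carrier G" "x \<in> carrier G" for g x
  proof -
    have "commutator G g (inv x) \<otimes> commutator G g x = commutator G g x \<otimes> commutator G g (inv x)"
      using comm[of "commutator G g x" "commutator G g (inv x)"] that by (simp add: com_closed)
    also have "\<dots> = \<one>"
      using prod[of g x "inv x"] that by (simp add: commutator_def[of G g \<one>])
    finally show ?thesis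
      by (rule inv_equality) (use that in \<open>auto simp: commutator_def\<close>)
  qed
  have memI: "f \<in> carrier (Homc G H n)"
    if "f \<in> extensional (carrier ?Q)" "\<And>C. C \<in> carrier ?Q \<Longrightarrow> f C \<in> ?L"
       "\<And>C D. C \<in> carrier ?Q \<Longrightarrow> D \<in> carrier ?Q \<Longrightarrow> f (C \<otimes>\<^bsub>?Q\<^esub> D) = f C \<otimes> f D"
       "\<And>g. g \<in> carrier G \<Longrightarrow> \<exists>x \<in> ?K. f (H #> g) = commutator G g x" for f
    using that by (auto simp: Homc_def hom_def Bex_def conj_commute)
  have ext: "f \<in> extensional (carrier ?Q)"
    and cl: "C \<in> carrier ?Q \<Longrightarrow> f C \<in> ?L"
    and hm: "C \<in> carrier ?Q \<Longrightarrow> D \<in> carrier ?Q \<Longrightarrow> f (C \<otimes>\<^bsub>?Q\<^esub> D) = f C \<otimes> f D"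
    and cm: "g \<in> carrier G \<Longrightarrow> \<exists>x \<in> ?K. f (H #> g) = commutator G g x"
    if "f \<in> carrier (Homc G H n)" for f C D g
    using that by (auto simp: Homc_def hom_def)
  have mult: "f \<otimes>\<^bsub>Homc G H n\<^esub> f' = (\<lambda>C \<in> carrier ?Q. f C \<otimes> f' C)" for f f'
    by (simp add: Homc_def)
  have one: "\<one>\<^bsub>Homc G H n\<^esub> = (\<lambda>C \<in> carrier ?Q. \<one>)"
    by (simp add: Homc_def)
  have one_mem: "\<one>\<^bsub>Homc G H n\<^esub> \<in> carrier (Homc G H n)"
    unfolding one
    by (rule memI) (use Q.m_closed coset K.one_closed in \<open>auto simp: commutator_def intro!: bexI[of _ \<one>]\<close>)
  show ?thesis
  proof (rule groupI)
    fix f f' assume f: "f \<in> carrier (Homc G H n)" "f' \<in> carrier (Homc G H n)"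
    show "f \<otimes>\<^bsub>Homc G H n\<^esub> f' \<in> carrier (Homc G H n)"
      unfolding mult
    proof (rule memI)
      fix C D assume CD: "C \<in> carrier ?Q" "D \<in> carrier ?Q"
      have l: "f C \<in> carrier G" "f D \<in> carrier G" "f' C \<in> carrier G" "f' D \<in> carrier G"
        using CD f cl L.mem_carrier by blast+
      have "f C \<otimes> f D \<otimes> (f' C \<otimes> f' D) = f C \<otimes> (f D \<otimes> f' C) \<otimes> f' D"
        using l by (simp add: m_assoc)
      also have "\<dots> = f C \<otimes> (f' C \<otimes> f D) \<otimes> f' D"
        using comm[OF cl[OF f(1) CD(2)] l(3)] by simp
      also have "\<dots> = f C \<otimes> f' C \<otimes> (f D \<otimes> f' D)"
        using l by (simp add: m_assoc)
      finally show "(\<lambda>C \<in> carrier ?Q. f C \<otimes> f' C) (C \<otimes>\<^bsub>?Q\<^esub> D) =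
          (\<lambda>C \<in> carrier ?Q. f C \<otimes> f' C) C \<otimes> (\<lambda>C \<in> carrier ?Q. f C \<otimes> f' C) D"
        using CD Q.m_closed[OF CD] hm[OF f(1) CD] hm[OF f(2) CD] by (simp del: mult_FactGroup)
    next
      fix g assume g: "g \<in> carrier G"
      obtain x y where xy: "x \<in> ?K" "f (H #> g) = commutator G g x"
        "y \<in> ?K" "f' (H #> g) = commutator G g y"
        using cm[OF f(1) g] cm[OF f(2) g] by blast
      then have "f (H #> g) \<otimes> f' (H #> g) = commutator G g (x \<otimes> y)"
        using prod[of g x y] cl[OF f(1) coset[OF g]] g by simp
      then show "\<exists>x \<in> ?K. (\<lambda>C \<in> carrier ?Q. f C \<otimes> f' C) (H #> g) = commutator G g x"
        using xy coset[OF g] by (intro bexI[of _ "x \<otimes> y"]) (simp, rule K.m_closed)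
    qed (use f cl in auto)
  next
    fix f assume f: "f \<in> carrier (Homc G H n)"
    show "\<one>\<^bsub>Homc G H n\<^esub> \<otimes>\<^bsub>Homc G H n\<^esub> f = f"
      unfolding mult one
      by (rule extensionalityI[OF _ ext[OF f]]) (use cl[OF f] in auto)
    let ?i = "\<lambda>C \<in> carrier ?Q. inv (f C)"
    have "?i \<in> carrier (Homc G H n)"
    proof (rule memI)
      fix C D assume CD: "C \<in> carrier ?Q" "D \<in> carrier ?Q"
      have l: "f C \<in> carrier G" "f D \<in> carrier G"
        using CD f cl L.mem_carrier by blast+
      have "inv (f C \<otimes> f D) = inv (f C) \<otimes> inv (f D)"
        using comm[OF cl[OF f CD(1)] l(2)] l by (simp add: inv_mult_group)
      then show "?i (C \<otimes>\<^bsub>?Q\<^esub> D) = ?i C \<otimes> ?i D"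
        using CD Q.m_closed[OF CD] hm[OF f CD] by (simp del: mult_FactGroup)
    next
      fix g assume g: "g \<in> carrier G"
      obtain x where x: "x \<in> ?K" "f (H #> g) = commutator G g x"
        using cm[OF f g] by blast
      then have "inv (f (H #> g)) = commutator G g (inv x)"
        using inv_comm[of g x] cl[OF f coset[OF g]] g by simp
      then show "\<exists>x \<in> ?K. ?i (H #> g) = commutator G g x"
        using x coset[OF g] by (intro bexI[of _ "inv x"]) (simp, rule K.m_inv_closed)
    qed (use cl[OF f] in auto)
    moreover have "?i \<otimes>\<^bsub>Homc G H n\<^esub> f = \<one>\<^bsub>Homc G H n\<^esub>"
      unfolding mult one by (rule restrict_ext) (use cl[OF f] in auto)
    ultimately show "\<exists>i \<in> carrier (Homc G H n). i \<otimes>\<^bsub>Homc G H n\<^esub> f = \<one>\<^bsub>Homc G H n\<^esub>"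
      by blast
  next
    fix f f' f'' assume f: "f \<in> carrier (Homc G H n)" "f' \<in> carrier (Homc G H n)"
      "f'' \<in> carrier (Homc G H n)"
    show "f \<otimes>\<^bsub>Homc G H n\<^esub> f' \<otimes>\<^bsub>Homc G H n\<^esub> f'' =
        f \<otimes>\<^bsub>Homc G H n\<^esub> (f' \<otimes>\<^bsub>Homc G H n\<^esub> f'')"
      unfolding mult
      by (rule restrict_ext) (use cl[OF f(1)] cl[OF f(2)] cl[OF f(3)] in \<open>auto simp: m_assoc\<close>)
  qed (rule one_mem)
qed

end

end

(*
  A homomorphism f from G/H to gamma_n(G) with f(gH) in [g, gamma_{n-1}(G)] corresponds to the map
  g |-> g f(gH). Since [g,x] = g^-1 x^-1 g x, this map sends g to a conjugate x^-1 g x with x in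
  gamma_{n-1}(G), and it is multiplicative because gamma_n(G) is contained in H, hence central.
  Conversely, a class preserving automorphism beta fixes the central subgroup H pointwise, so
  g^-1 beta(g) depends only on gH, and beta(beta'(g)) = beta(g) (g^-1 beta'(g)), which turns
  composition into the pointwise product.
*)

theory Submission
  imports Defs
begin

context group
begin

lemma central_subgroup_normal:
  assumes "central_subgroup H G"
  shows "H \<lhd> G"
proof -
  have sub: "subgroup H G" using assms by (simp add: central_subgroup_def)
  have "x \<otimes> h \<otimes> inv x = h" if "x \<in> carrier G" "h \<in> H" for x h
    using that assms subgroup.mem_carrier[OF sub]
    by (auto simp: central_subgroup_def group_center_def inv_solve_right')
  then show ?thesis using sub by (simp add: normal_inv_iff)
qed

text \<open>The generators of \<open>lower_central\<close> carry the term of the series in the first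
  slot, while \<open>Homc\<close> has it in the second. Inverting a commutator swaps its arguments,
  and a subgroup is closed under inverses.\<close>

lemma commutator_mem_lower_central:
  assumes "g \<in> carrier G" "x \<in> lower_central G (Suc i)"
  shows "commutator G g x \<in> lower_central G (Suc (Suc i))"
proof -
  have x: "x \<in> carrier G"
    using subgroup.mem_carrier[OF lower_central_subgroup assms(2)] .
  have "commutator G x g \<in> lower_central G (Suc (Suc i))"
    using assms by (auto intro!: generate.incl)
  then have "inv (commutator G x g) \<in> lower_central G (Suc (Suc i))"
    by (rule subgroup.m_inv_closed[OF lower_central_subgroup])
  moreover have "inv (commutator G x g) = commutator G g x"
    using assms x by (simp add: commutator_def inv_mult_group m_assoc)
  ultimately show ?thesis by simp
qed

lemma conj_eq_mult_commutator:
  assumes "g \<in> carrier G" "x \<in> carrier G"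
  shows "inv x \<otimes> g \<otimes> x = g \<otimes> commutator G g x"
  using assms by (simp add: commutator_def m_assoc[symmetric])

text \<open>The map is written from \<open>Homc\<close> to \<open>Autc\<close> because this
  direction needs no value on a coset to be shown well defined; that question arises only in the
  proof of surjectivity.\<close>

lemma Homc_iso_Autc:
  assumes n: "n \<ge> 2" and H: "central_subgroup H G" and le: "lower_central G n \<subseteq> H"
  shows "(\<lambda>f. \<lambda>g \<in> carrier G. g \<otimes> f (H #> g)) \<in> iso (Homc G H n) (Autc (n - 1) G)"
proof -
  let ?L = "lower_central G n" and ?K = "lower_central G (n - 1)" and ?Q = "G Mod H"
  let ?\<Psi> = "\<lambda>f. \<lambda>g \<in> carrier G. g \<otimes> f (H #> g)"
  interpret N: normal H G by (rule central_subgroup_normal[OF H])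
  interpret L: subgroup ?L G by (rule lower_central_subgroup)
  interpret K: subgroup ?K G by (rule lower_central_subgroup)
  have comm: "c \<otimes> g = g \<otimes> c" if "c \<in> H" "g \<in> carrier G" for c g
    using that H by (auto simp: central_subgroup_def group_center_def)
  have Q: "carrier ?Q = (\<lambda>g. H #> g) ` carrier G"
    by (auto simp: FactGroup_def RCOSETS_def)
  have coset_mult: "(H #> g) \<otimes>\<^bsub>?Q\<^esub> (H #> h) = H #> (g \<otimes> h)"
    if "g \<in> carrier G" "h \<in> carrier G" for g h
    using that by (simp add: N.rcos_sum)
  \<comment> \<open>Centrality turns \<open>g \<otimes> z\<close> into \<open>z \<otimes> g\<close>,
    and \<open>H\<close> absorbs \<open>z\<close>. Hence multiplying g by a value of f, which lies
    in \<open>H\<close>, leaves its coset unchanged.\<close>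
  have coset_absorb: "H #> (g \<otimes> z) = H #> g" if "g \<in> carrier G" "z \<in> H" for g z
    using that comm[OF that(2,1)] coset_mult_assoc[OF N.subset N.mem_carrier[OF that(2)] that(1)]
      coset_join2[OF N.mem_carrier[OF that(2)] N.subgroup_axioms that(2)]
    by simp

  have ext: "f \<in> extensional (carrier ?Q)"
    and cl: "g \<in> carrier G \<Longrightarrow> f (H #> g) \<in> ?L"
    and hm: "g \<in> carrier G \<Longrightarrow> h \<in> carrier G \<Longrightarrow> f (H #> (g \<otimes> h)) = f (H #> g) \<otimes> f (H #> h)"
    and cm: "g \<in> carrier G \<Longrightarrow> \<exists>x \<in> ?K. f (H #> g) = commutator G g x"
    if "f \<in> carrier (Homc G H n)" for f g h
    using that by (auto simp: Homc_def hom_def Q coset_mult[symmetric] simp del: mult_FactGroup)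
  have clG: "f (H #> g) \<in> carrier G" if "f \<in> carrier (Homc G H n)" "g \<in> carrier G" for f g
    using cl[OF that] by (rule L.mem_carrier)
  have clH: "f (H #> g) \<in> H" if "f \<in> carrier (Homc G H n)" "g \<in> carrier G" for f g
    using cl[OF that] le by blast

  have Autc_carrier: "carrier (Autc m G) = class_preserving_auto m G" for m
    by (simp add: Autc_def)
  \<comment> \<open>The product of \<open>BijGroup\<close> is restricted to bijections, so it
    unfolds to \<open>compose\<close> only for members.\<close>
  have Autc_mult: "\<beta> \<otimes>\<^bsub>Autc (n - 1) G\<^esub> \<beta>' = compose (carrier G) \<beta> \<beta>'"
    if "\<beta> \<in> carrier (Autc (n - 1) G)" "\<beta>' \<in> carrier (Autc (n - 1) G)" for \<beta> \<beta>'
    using that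
    by (simp add: Autc_def AutoGroup_def BijGroup_def class_preserving_auto_def auto_def)

  have \<Psi>_mem: "?\<Psi> f \<in> carrier (Autc (n - 1) G)" if f: "f \<in> carrier (Homc G H n)" for f
  proof -
    have "?\<Psi> f \<in> hom G G"
    proof (rule homI)
      fix g h assume gh: "g \<in> carrier G" "h \<in> carrier G"
      \<comment> \<open>The only reordering is that the central value \<open>f (H #> g)\<close>
        moves past h.\<close>
      have "g \<otimes> h \<otimes> (f (H #> g) \<otimes> f (H #> h)) = g \<otimes> (h \<otimes> f (H #> g)) \<otimes> f (H #> h)"
        using gh clG[OF f] by (simp add: m_assoc)
      also have "\<dots> = g \<otimes> f (H #> g) \<otimes> (h \<otimes> f (H #> h))"
        using gh clG[OF f] comm[OF clH[OF f gh(1)] gh(2), symmetric] by (simp add: m_assoc)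
      finally show "?\<Psi> f (g \<otimes> h) = ?\<Psi> f g \<otimes> ?\<Psi> f h"
        using gh hm[OF f gh] by simp
    qed (use clG[OF f] in auto)
    moreover have "bij_betw (?\<Psi> f) (carrier G) (carrier G)"
    \<comment> \<open>An explicit inverse: neither map leaves the coset of its argument, so both use
      the same value of f and the two factors cancel.\<close>
    proof (rule bij_betwI[where g = "\<lambda>g. g \<otimes> inv (f (H #> g))"])
      show "?\<Psi> f \<in> carrier G \<rightarrow> carrier G" "(\<lambda>g. g \<otimes> inv (f (H #> g))) \<in> carrier G \<rightarrow> carrier G"
        using clG[OF f] by auto
      fix g assume g: "g \<in> carrier G"
      show "?\<Psi> f g \<otimes> inv (f (H #> ?\<Psi> f g)) = g"
        using g clG[OF f g] coset_absorb[OF g clH[OF f g]] by (simp add: m_assoc)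
      show "?\<Psi> f (g \<otimes> inv (f (H #> g))) = g"
        using g clG[OF f g] coset_absorb[OF g N.m_inv_closed[OF clH[OF f g]]]
        by (simp add: m_assoc)
    qed
    moreover have "\<exists>x \<in> ?K. ?\<Psi> f g = inv x \<otimes> g \<otimes> x" if g: "g \<in> carrier G" for g
    proof -
      obtain x where "x \<in> ?K" "f (H #> g) = commutator G g x"
        using cm[OF f g] by blast
      then show ?thesis
        using g by (auto simp: conj_eq_mult_commutator)
    qed
    ultimately show ?thesis
      by (simp add: Autc_carrier class_preserving_auto_def auto_def Bij_def)
  qed

  have \<Psi>_mult: "?\<Psi> (f \<otimes>\<^bsub>Homc G H n\<^esub> f') = ?\<Psi> f \<otimes>\<^bsub>Autc (n - 1) G\<^esub> ?\<Psi> f'"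
    if f: "f \<in> carrier (Homc G H n)" "f' \<in> carrier (Homc G H n)" for f f'
  proof -
    \<comment> \<open>The inner map keeps g in its coset, so the outer one multiplies by
      \<open>f (H #> g)\<close>; the two central values then commute.\<close>
    have "g \<otimes> (f (H #> g) \<otimes> f' (H #> g)) = ?\<Psi> f (?\<Psi> f' g)" if g: "g \<in> carrier G" for g
      using g clG[OF f(1) g] clG[OF f(2) g] coset_absorb[OF g clH[OF f(2) g]]
        comm[OF clH[OF f(1) g] clG[OF f(2) g]]
      by (simp add: m_assoc)
    then have "?\<Psi> (f \<otimes>\<^bsub>Homc G H n\<^esub> f') = compose (carrier G) (?\<Psi> f) (?\<Psi> f')"
      by (auto simp: Homc_def compose_def Q fun_eq_iff)
    then show ?thesis using Autc_mult \<Psi>_mem f by metis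
  qed

  have \<Psi>_inj: "f = f'"
    if f: "f \<in> carrier (Homc G H n)" "f' \<in> carrier (Homc G H n)" and eq: "?\<Psi> f = ?\<Psi> f'" for f f'
  proof (rule extensionalityI[OF ext[OF f(1)] ext[OF f(2)]])
    fix C assume "C \<in> carrier ?Q"
    then obtain g where g: "g \<in> carrier G" "C = H #> g" by (auto simp: Q)
    then show "f C = f' C"
      using fun_cong[OF eq, of g] clG[OF f(1)] clG[OF f(2)] by simp
  qed

  have \<Psi>_surj: "\<exists>f \<in> carrier (Homc G H n). \<beta> = ?\<Psi> f" if "\<beta> \<in> carrier (Autc (n - 1) G)" for \<beta>
  proof -
    have hom: "\<beta> \<in> hom G G" and \<beta>_ext: "\<beta> \<in> extensional (carrier G)"
      and conj: "\<And>g. g \<in> carrier G \<Longrightarrow> \<exists>x \<in> ?K. \<beta> g = inv x \<otimes> g \<otimes> x"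
      using that by (auto simp: Autc_carrier class_preserving_auto_def auto_def Bij_def)
    have \<beta>_cl: "\<beta> g \<in> carrier G" if "g \<in> carrier G" for g
      using hom_in_carrier[OF hom that] .
    let ?d = "\<lambda>g. inv g \<otimes> \<beta> g"
    have d_cm: "\<exists>x \<in> ?K. ?d g = commutator G g x" if "g \<in> carrier G" for g
      using conj[OF that] that by (auto simp: commutator_def m_assoc)
    \<comment> \<open>Here n \<ge> 2 makes \<open>n - 1\<close> equal to \<open>Suc i\<close>, away
      from the conventional index 0, so that commutators with \<open>?K\<close> land in
      \<open>?L\<close>.\<close>
    obtain i where i: "n = Suc (Suc i)" using n by (metis Suc_le_D numeral_2_eq_2 Suc_le_mono)
    have d_L: "?d g \<in> ?L" if "g \<in> carrier G" for g
      using d_cm[OF that] commutator_mem_lower_central[OF that] unfolding i by auto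
    have d_clG: "?d g \<in> carrier G" if "g \<in> carrier G" for g
      using d_L[OF that] by (rule L.mem_carrier)
    have d_mult: "?d (g \<otimes> h) = ?d g \<otimes> ?d h" if "g \<in> carrier G" "h \<in> carrier G" for g h
    proof -
      have "?d (g \<otimes> h) = inv h \<otimes> ?d g \<otimes> \<beta> h"
        using that \<beta>_cl hom_mult[OF hom that] by (simp add: inv_mult_group m_assoc)
      \<comment> \<open>The value \<open>?d g\<close> lies in \<open>?L\<close>, hence in
        \<open>H\<close>, and so commutes with \<open>inv h\<close>.\<close>
      also have "\<dots> = ?d g \<otimes> inv h \<otimes> \<beta> h"
        using comm[of "?d g" "inv h"] d_L[OF that(1)] le that(2) by auto
      also have "\<dots> = ?d g \<otimes> ?d h"
        using that \<beta>_cl by (simp add: m_assoc)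
      finally show ?thesis .
    qed
    \<comment> \<open>Conjugation fixes central elements. Together with \<open>d_mult\<close> this
      makes \<open>?d\<close> constant on each coset of \<open>H\<close>.\<close>
    have d_H: "?d h = \<one>" if "h \<in> H" for h
    proof -
      have h: "h \<in> carrier G" using that by (rule N.mem_carrier)
      obtain x where x: "x \<in> ?K" "\<beta> h = inv x \<otimes> h \<otimes> x" using conj[OF h] by blast
      then have "\<beta> h = h"
        using comm[OF that K.mem_carrier[OF x(1)]] h by (simp add: m_assoc inv_solve_left')
      then show ?thesis using h by simp
    qed
    have d_coset: "?d ` (H #> g) = {?d g}" if g: "g \<in> carrier G" for g
    proof -
      have "?d y = ?d g" if y: "y \<in> H #> g" for y
      proof -
        obtain h where h: "h \<in> H" "y = h \<otimes> g" using y by (auto simp: r_coset_def)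
        then show ?thesis
          using d_mult[of h g] d_H[OF h(1)] d_clG[OF g] g by simp
      qed
      then show ?thesis using rcos_self[OF g N.subgroup_axioms] by blast
    qed
    \<comment> \<open>The image of a coset under \<open>?d\<close> is a singleton by
      \<open>d_coset\<close>, so \<open>the_elem\<close> yields the common value without choosing a
      representative.\<close>
    define f where "f = (\<lambda>C \<in> carrier ?Q. the_elem (?d ` C))"
    have f_coset: "f (H #> g) = ?d g" if "g \<in> carrier G" for g
      using that by (simp add: f_def Q d_coset)
    have "f \<in> hom ?Q (G\<lparr>carrier := ?L\<rparr>)"
    proof (rule homI)
      fix C assume "C \<in> carrier ?Q"
      then show "f C \<in> carrier (G\<lparr>carrier := ?L\<rparr>)"
        using d_L by (auto simp: Q f_coset)
    next
      fix C D assume "C \<in> carrier ?Q" "D \<in> carrier ?Q"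
      then obtain g h where gh: "g \<in> carrier G" "h \<in> carrier G" "C = H #> g" "D = H #> h"
        by (auto simp: Q)
      then show "f (C \<otimes>\<^bsub>?Q\<^esub> D) = f C \<otimes>\<^bsub>G\<lparr>carrier := ?L\<rparr>\<^esub> f D"
        using d_mult[OF gh(1,2)]
        by (simp only: coset_mult f_coset m_closed) simp
    qed
    moreover have "f \<in> extensional (carrier ?Q)" by (simp add: f_def)
    moreover have "\<exists>x. f (H #> g) = commutator G g x \<and> x \<in> ?K" if "g \<in> carrier G" for g
      using d_cm[OF that] by (auto simp: f_coset[OF that])
    ultimately have "f \<in> carrier (Homc G H n)"
      by (simp add: Homc_def)
    moreover have "\<beta> = ?\<Psi> f"
    proof (rule extensionalityI[OF \<beta>_ext])
      fix g assume "g \<in> carrier G"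
      then show "\<beta> g = ?\<Psi> f g"
        using \<beta>_cl by (simp add: f_coset m_assoc[symmetric])
    qed simp
    ultimately show ?thesis by blast
  qed

  have "?\<Psi> \<in> hom (Homc G H n) (Autc (n - 1) G)"
    by (rule homI) (fact \<Psi>_mem \<Psi>_mult)+
  moreover have "bij_betw ?\<Psi> (carrier (Homc G H n)) (carrier (Autc (n - 1) G))"
    unfolding bij_betw_def inj_on_def using \<Psi>_mem \<Psi>_inj \<Psi>_surj by blast
  ultimately show ?thesis by (simp add: iso_def)
qed

end

theorem theorem3p4:
  fixes G :: "('a, 'b) monoid_scheme" and H :: "'a set" and n :: nat
  assumes "n \<ge> 2"
    and "group G"
    and "finite (carrier G)"
    and "nilpotent_group G"
    and "nilpotency_class G \<le> n"
    and "central_subgroup H G"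
    and "lower_central G n \<subseteq> H"
  shows "Autc (n - 1) G \<cong> Homc G H n"
proof -
  interpret group G by fact
  have "Homc G H n \<cong> Autc (n - 1) G"
    using Homc_iso_Autc[OF assms(1,6,7)] by (auto simp: is_iso_def)
  \<comment> \<open>Reversing the isomorphism requires its source to be a group, which
    \<open>group_Homc\<close> provides.\<close>
  then show ?thesis
    by (rule group.iso_sym[OF group_Homc[OF assms(6,7)]])
qed

end
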